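(* Let $0\le b\le 1/2$ and let $f\in L^2(\mathbb{T})$, $\mathbb{T}=\mathbb{R}/\mathbb{Z}$, satisfy $$\sum_{n\in\mathbb{Z}}|\hat f(n)|^2|n|^{2b}\log_2^2(|n|+1)<\infty .$$ Let $E\subset\mathbb{T}$ be a Lebesgue measurable set of Fourier dimension strictly greater than $1-2b$. Then the Fourier series $\sum_{n\in\mathbb{Z}}\hat f(n)\exp(2\pi i n t)$ of $f$ does not diverge everywhere on $E$; that is, there is at least one $t\in E$ at which it converges.
   Context: $\hat f(n)=\int_{\mathbb{T}}f(x)\exp(-2\pi i n x)\,dx$ and $\hat\mu(n)=\int_{\mathbb{T}}\exp(2\pi i n x)\,d\mu(x)$. The Fourier dimension of a Lebesgue measurable set $E\subset\mathbb{T}$ is the supremum of the numbers $0\le\alpha\le1$ such that $E$ supports a Borel probability measure $\mu$ (i.e. $\mu$ is concentrated on $E$: the complement of $E$ is $\mu$-null) with $|\hat\mu(u)|^2=o(|u|^{-\alpha})$ as $|u|\to\infty$. $\log_2$ is the base-2 logarithm and $\log_2^2(x)=(\log_2x)^2$. Convergence of the Fourier series means convergence of the symmetric partial sums $\sum_{|n|\le N}\hat f(n)\exp(2\pi i n t)$ as $N\to\infty$. *)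

theory Defs
  imports "HOL-Probability.Probability" "HOL-Library.Landau_Symbols"
begin

text \<open>
  The torus \<open>\<real>/\<int>\<close> is represented by its fundamental domain \<open>[0,1)\<close>. The bijection between the
  two preserves Borel sets, Lebesgue measurable sets and Lebesgue measure.
\<close>

definition torus :: "real set" where
  "torus = {0..<1}"

definition torus_lebesgue :: "real measure" where
  "torus_lebesgue = lebesgue_on torus"

definition torus_borel :: "real measure" where
  "torus_borel = restrict_space borel torus"

definition L2_torus :: "(real \<Rightarrow> complex) set" where
  "L2_torus = {f. f \<in> borel_measurable torus_lebesgue \<and>
                  integrable torus_lebesgue (\<lambda>x. (cmod (f x))\<^sup>2)}"

definition torus_char :: "int \<Rightarrow> real \<Rightarrow> complex" where
  "torus_char n x = exp (2 * of_real pi * \<i> * of_int n * of_real x)"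

definition fourier_coeff :: "(real \<Rightarrow> complex) \<Rightarrow> int \<Rightarrow> complex" where
  "fourier_coeff f n = (LINT x|torus_lebesgue. f x * torus_char (- n) x)"

definition fourier_measure :: "real measure \<Rightarrow> int \<Rightarrow> complex" where
  "fourier_measure \<mu> n = (LINT x|\<mu>. torus_char n x)"

text \<open>
  The set need not be Borel: \<open>AE x in \<mu>. x \<in> E\<close> says that the complement of \<open>E\<close> is contained in a
  Borel set of \<open>\<mu>\<close>-measure zero, i.e. that it is null for the completion of \<open>\<mu>\<close>.
\<close>

definition supports_prob_measure :: "real set \<Rightarrow> real measure \<Rightarrow> bool" where
  "supports_prob_measure E \<mu> \<longleftrightarrow>
     prob_space \<mu> \<and> sets \<mu> = sets torus_borel \<and> (AE x in \<mu>. x \<in> E)"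

text \<open>
  The element \<open>0\<close> is inserted only to fix the value of the supremum (taken in \<open>[0,1]\<close>) when no
  exponent is admissible.
\<close>

definition fourier_dim :: "real set \<Rightarrow> real" where
  "fourier_dim E = Sup (insert 0 {\<alpha>. 0 \<le> \<alpha> \<and> \<alpha> \<le> 1 \<and>
     (\<exists>\<mu>. supports_prob_measure E \<mu> \<and>
        (\<lambda>u::int. (cmod (fourier_measure \<mu> u))\<^sup>2)
          \<in> o[filtercomap (\<lambda>u. \<bar>u\<bar>) at_top](\<lambda>u. \<bar>real_of_int u\<bar> powr (- \<alpha>)))})"

definition fourier_partial_sum :: "(real \<Rightarrow> complex) \<Rightarrow> nat \<Rightarrow> real \<Rightarrow> complex" where
  "fourier_partial_sum f N t = (\<Sum>n | \<bar>n\<bar> \<le> int N. fourier_coeff f n * torus_char n t)"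

end

theory Submission
  imports Defs
begin

text \<open>
  Write \<open>c\<^sub>n\<close> for the Fourier coefficients of \<open>f\<close>. A dimension above \<open>1 - 2b\<close> yields a
  probability measure \<open>\<mu>\<close> on \<open>E\<close> with \<open>|\<mu>^(n)|\<^sup>2 \<le> |n| powr - \<alpha>\<close> for large \<open>|n|\<close> and some
  \<open>\<alpha> > 1 - 2b\<close>. It suffices that the partial sums converge \<open>\<mu>\<close>-almost everywhere: then the points of
  convergence and \<open>E\<close> both have full measure, so they meet.

  Decay enters only through a finite energy: \<open>\<Sum>d. |\<mu>^(d)|\<^sup>2 (d+1) powr - \<gamma>\<close> converges for some
  \<open>\<gamma>\<close> with \<open>1 - \<alpha> < \<gamma> < 2b\<close> (\<open>summable_energy_of_smallo\<close>). Let \<open>M\<^sub>k(t)\<close> be the largest modulus of a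
  truncation \<open>\<Sum>{c\<^sub>n e(nt). 2^k \<le> |n| \<le> m}\<close> with \<open>m < 2^(k+1)\<close>. The heart of the
  proof is the estimate (\<open>integral_block_max_le\<close>)

  \<open>\<integral> M\<^sub>k d\<mu> \<le> sqrt (\<Sum>{|c\<^sub>n|\<^sup>2. 2^k \<le> |n| < 2^(k+1)}) * sqrt (C * 2 powr (\<gamma>k))\<close>.

  Since the sum of \<open>|c\<^sub>n|\<^sup>2\<close> over the block is \<open>O(2 powr (-2bk))\<close>, the right-hand sides decay
  geometrically. Hence \<open>\<Sum>k. M\<^sub>k\<close> has finite integral and is finite \<open>\<mu>\<close>-almost everywhere, and where it
  is finite the partial sums form a Cauchy sequence
  (\<open>convergent_partial_sum_of_summable_block_max\<close>).

  The estimate for \<open>M\<^sub>k\<close> follows the Kolmogorov--Seliverstov--Plessner method. Let \<open>m(x)\<close> be the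
  truncation that attains the maximum at \<open>x\<close>, and let \<open>\<epsilon>(x)\<close> be a factor of modulus at most \<open>1\<close> that
  turns the truncated sum into its modulus. With \<open>m\<close> and \<open>\<epsilon>\<close> fixed, the integral of \<open>M\<^sub>k\<close> is a linear
  form in \<open>c\<close>, and the Cauchy--Schwarz
  inequality leaves \<open>\<Sum>n. |\<integral> g\<^sub>n d\<mu>|\<^sup>2\<close> with \<open>g\<^sub>n(x) = \<epsilon>(x) 1[2^k \<le> |n| \<le> m(x)] e(nx)\<close>. This is the double
  integral of the kernel \<open>\<Sum>n. g\<^sub>n(x) cnj g\<^sub>n(y)\<close>, whose modulus is at most that of an exponential sum
  over \<open>2^k \<le> |n| \<le> min m(x) m(y)\<close> at the point \<open>x - y\<close>. Such a sum is dominated, uniformly in the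
  truncation, by a sum of Fejer kernels (\<open>geometric_sum_le_fejer\<close>), and the double integral of these
  is a nonnegative combination of the numbers \<open>|\<mu>^(n)|\<^sup>2\<close> (\<open>sum_norm_integral_le_of_kernel_le\<close>).
\<close>

section \<open>Characters of the torus\<close>

lemma norm_torus_char [simp]: "cmod (torus_char n x) = 1"
proof -
  have "2 * of_real pi * \<i> * of_int n * of_real x = \<i> * of_real (2 * pi * of_int n * x)"
    by simp
  then show ?thesis
    unfolding torus_char_def by (metis norm_exp_i_times)
qed

lemma torus_char_add: "torus_char (m + n) x = torus_char m x * torus_char n x"
  unfolding torus_char_def exp_add[symmetric] by (simp add: algebra_simps)

lemma torus_char_uminus: "torus_char (- n) x = cnj (torus_char n x)"
  unfolding torus_char_def exp_cnj by simp

lemma torus_char_diff: "torus_char (m - n) x = torus_char m x * cnj (torus_char n x)"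
  using torus_char_add[of m "- n" x] by (simp add: torus_char_uminus)

lemma torus_char_arg_diff: "torus_char n (x - y) = torus_char n x * cnj (torus_char n y)"
  unfolding torus_char_def exp_cnj exp_add[symmetric] by (simp add: algebra_simps)

lemma torus_char_power: "torus_char (int n) x = torus_char 1 x ^ n"
  unfolding torus_char_def exp_of_nat_mult[symmetric] by (simp add: algebra_simps)

lemma fourier_measure_uminus: "fourier_measure \<mu> (- n) = cnj (fourier_measure \<mu> n)"
  by (simp add: fourier_measure_def torus_char_uminus)

lemma torus_char_measurable:
  assumes "sets \<mu> = sets torus_borel"
  shows "torus_char n \<in> borel_measurable \<mu>"
proof -
  have "continuous_on UNIV (torus_char n)"
    unfolding torus_char_def by (intro continuous_intros)
  then have "torus_char n \<in> borel_measurable borel"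
    by (rule borel_measurable_continuous_onI)
  then have "torus_char n \<in> borel_measurable torus_borel"
    unfolding torus_borel_def by (rule measurable_restrict_space1)
  then show ?thesis
    using measurable_cong_sets[OF assms refl] by blast
qed


section \<open>Exponential sums and Fejer kernels\<close>

lemma geometric_sum_ge_half:
  fixes z :: complex
  assumes "norm z = 1" and "2 * real M * norm (z - 1) \<le> 1"
  shows "real M / 2 \<le> norm (\<Sum>n<M. z ^ n)"
proof -
  have close: "norm (z ^ n - 1) \<le> 1 / 2" if "n < M" for n
  proof -
    have "norm (z ^ n - 1 ^ n) \<le> real n * norm (z - 1)"
      by (rule norm_power_diff) (use assms in auto)
    also have "\<dots> \<le> real M * norm (z - 1)"
      using that by (intro mult_right_mono) auto
    finally show ?thesis using assms(2) by simp
  qed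
  have "norm ((\<Sum>n<M. z ^ n) - of_nat M) = norm (\<Sum>n<M. z ^ n - 1)"
    by (simp add: sum_subtractf)
  also have "\<dots> \<le> (\<Sum>n<M. 1 / 2)"
    by (rule sum_norm_le) (use close in auto)
  finally have "norm ((\<Sum>n<M. z ^ n) - of_nat M) \<le> real M / 2" by simp
  moreover have "real M \<le> norm (\<Sum>n<M. z ^ n) + norm ((\<Sum>n<M. z ^ n) - of_nat M)"
    using norm_triangle_ineq4[of "\<Sum>n<M. z ^ n" "(\<Sum>n<M. z ^ n) - of_nat M"] by simp
  ultimately show ?thesis by linarith
qed

text \<open>
  With \<open>d = |z - 1|\<close>, the left-hand side is at most both \<open>L\<close> and \<open>2 / d\<close>. The Fejer kernel of order
  \<open>2^j\<close> is at least \<open>2^j / 4\<close> as long as \<open>2 * 2^j * d \<le> 1\<close>, because then all powers in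
  it stay close to \<open>1\<close>. Hence the single kernel with the largest such \<open>j \<le> k\<close> already dominates;
  summing over \<open>j\<close> makes the bound independent of \<open>z\<close>. Unlike \<open>min L (2 / d)\<close>, the resulting
  majorant is a trigonometric polynomial with nonnegative coefficients, so that its energy can be read
  off from Fourier coefficients.
\<close>

lemma geometric_sum_le_fejer:
  fixes z :: complex
  assumes z: "norm z = 1" and L: "L \<le> 2 ^ k"
  shows "norm (\<Sum>n<L. z ^ n) \<le> 32 * (\<Sum>j\<le>k. (norm (\<Sum>n<2 ^ j. z ^ n))\<^sup>2 / 2 ^ j)"
proof -
  define d where "d = norm (z - 1)"
  define D where "D M = norm (\<Sum>n<M. z ^ n)" for M
  \<comment> \<open>The alternative \<open>i = 0\<close> covers points far from \<open>1\<close>; the kernel of order \<open>1\<close> is constant.\<close>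
  define P where "P = (\<lambda>i. i \<le> k \<and> (i = 0 \<or> 2 * 2 ^ i * d \<le> 1))"
  define j where "j = (GREATEST i. P i)"
  have "P 0" by (simp add: P_def)
  then have Pj: "P j" and max: "\<And>i. P i \<Longrightarrow> i \<le> j"
    unfolding j_def
    by (rule GreatestI_nat[where b = k], simp_all add: P_def)
       (rule Greatest_le_nat[where b = k], auto)
  have lower: "2 ^ j / 2 \<le> D (2 ^ j)"
    using Pj geometric_sum_ge_half[OF z, of "2 ^ j"] by (auto simp: P_def D_def d_def)
  have upper: "D L \<le> 8 * 2 ^ j"
  proof (cases "j = k")
    case True
    have "D L \<le> (\<Sum>n<L. 1)"
      unfolding D_def by (rule sum_norm_le) (simp add: norm_power z)
    also have "\<dots> = real L" by simp
    also have "\<dots> \<le> real (2 ^ k)" using L by (subst of_nat_le_iff)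
    also have "\<dots> \<le> 8 * 2 ^ j" using True by simp
    finally show ?thesis .
  next
    case False
    then have "\<not> P (Suc j)" "Suc j \<le> k"
      using Pj max[of "Suc j"] by (auto simp: P_def)
    then have d: "1 < 4 * 2 ^ j * d" by (simp add: P_def)
    have "D L * d = norm (z ^ L - 1)"
      unfolding D_def d_def by (simp add: power_diff_1_eq norm_mult mult.commute)
    also have "\<dots> \<le> 2"
      using norm_triangle_ineq4[of "z ^ L" 1] by (simp add: norm_power z)
    finally have "D L * d \<le> 2" .
    also have "2 < 8 * 2 ^ j * d" using d by linarith
    finally have "D L * d < 8 * 2 ^ j * d" .
    then show ?thesis
      using mult_right_less_imp_less[of "D L" d "8 * 2 ^ j"] by (simp add: d_def)
  qed
  have "(2 ^ j / 2) * (2 ^ j / 2) \<le> D (2 ^ j) * D (2 ^ j)"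
    by (rule mult_mono) (use lower in \<open>auto simp: D_def\<close>)
  then have "8 * 2 ^ j \<le> 32 * ((D (2 ^ j))\<^sup>2 / 2 ^ j)"
    by (simp add: field_simps power2_eq_square)
  also have "(D (2 ^ j))\<^sup>2 / 2 ^ j \<le> (\<Sum>j\<le>k. (D (2 ^ j))\<^sup>2 / 2 ^ j)"
    by (rule member_le_sum) (use Pj in \<open>auto simp: P_def\<close>)
  finally show ?thesis using upper by (simp add: D_def)
qed

definition freq_block :: "nat \<Rightarrow> int set" where
  "freq_block k = {n. 2 ^ k \<le> \<bar>n\<bar> \<and> \<bar>n\<bar> < 2 ^ Suc k}"

definition freq_block_upto :: "nat \<Rightarrow> nat \<Rightarrow> int set" where
  "freq_block_upto k m = {n. 2 ^ k \<le> \<bar>n\<bar> \<and> \<bar>n\<bar> \<le> int m}"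

lemma finite_freq_block [simp]: "finite (freq_block k)"
  by (rule finite_subset[of _ "{- (2 ^ Suc k)..2 ^ Suc k}"]) (auto simp: freq_block_def)

lemma finite_freq_block_upto [simp]: "finite (freq_block_upto k m)"
  by (rule finite_subset[of _ "{- int m..int m}"]) (auto simp: freq_block_upto_def)

lemma freq_block_upto_subset:
  assumes "m < 2 ^ Suc k"
  shows "freq_block_upto k m \<subseteq> freq_block k"
proof -
  have "int m < int (2 ^ Suc k)" using assms by (simp only: of_nat_less_iff)
  then have "int m < 2 ^ Suc k" by (simp only: of_nat_power of_nat_numeral)
  then show ?thesis by (auto simp: freq_block_upto_def freq_block_def)
qed

lemma freq_block_upto_Int:
  "freq_block_upto k m \<inter> freq_block_upto k m' = freq_block_upto k (min m m')"
  by (auto simp: freq_block_upto_def)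

text \<open>
  The positive and the negative frequencies contribute complex conjugate geometric sums, whence
  twice the constant of \<open>geometric_sum_le_fejer\<close>.
\<close>

lemma sum_torus_char_freq_block_upto:
  assumes "2 ^ k \<le> m" and "m < 2 ^ Suc k"
  shows "cmod (\<Sum>n\<in>freq_block_upto k m. torus_char n t)
         \<le> 64 * (\<Sum>j\<le>k. (cmod (\<Sum>n<2 ^ j. torus_char (int n) t))\<^sup>2 / 2 ^ j)"
proof -
  define z where "z = torus_char 1 t"
  define T where "T = {2 ^ k..m}"
  have z: "norm z = 1" by (simp add: z_def)
  have split: "freq_block_upto k m = int ` T \<union> (\<lambda>p. - int p) ` T"
  proof (intro equalityI subsetI)
    fix n assume "n \<in> freq_block_upto k m"
    then have n: "2 ^ k \<le> \<bar>n\<bar>" "\<bar>n\<bar> \<le> int m" by (auto simp: freq_block_upto_def)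
    then have "nat \<bar>n\<bar> \<in> T"
      by (auto simp: T_def nat_le_iff le_nat_iff)
    moreover have "n = int (nat \<bar>n\<bar>) \<or> n = - int (nat \<bar>n\<bar>)" by linarith
    ultimately show "n \<in> int ` T \<union> (\<lambda>p. - int p) ` T" by blast
  next
    fix n assume "n \<in> int ` T \<union> (\<lambda>p. - int p) ` T"
    then obtain p where p: "p \<in> T" "\<bar>n\<bar> = int p" by auto
    then have "(2::int) ^ k \<le> int p"
      by (simp add: T_def)
    with p show "n \<in> freq_block_upto k m" by (auto simp: freq_block_upto_def T_def)
  qed
  have pos: "0 < p" if "p \<in> T" for p
    using that zero_less_power[of "2::nat" k] unfolding T_def by (simp only: atLeastAtMost_iff) linarith
  have "(\<Sum>n\<in>freq_block_upto k m. torus_char n t)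
      = (\<Sum>n\<in>int ` T. torus_char n t) + (\<Sum>n\<in>(\<lambda>p. - int p) ` T. torus_char n t)"
    unfolding split by (rule sum.union_disjoint) (use pos in \<open>force simp: T_def\<close>)+
  also have "\<dots> = (\<Sum>p\<in>T. z ^ p) + cnj (\<Sum>p\<in>T. z ^ p)"
    by (simp add: sum.reindex inj_on_def torus_char_uminus torus_char_power z_def)
  finally have "cmod (\<Sum>n\<in>freq_block_upto k m. torus_char n t) \<le> 2 * cmod (\<Sum>p\<in>T. z ^ p)"
    using norm_triangle_ineq[of "\<Sum>p\<in>T. z ^ p" "cnj (\<Sum>p\<in>T. z ^ p)"]
    by (simp only: complex_mod_cnj)
  also have "(\<Sum>p\<in>T. z ^ p) = (\<Sum>p<Suc m - 2 ^ k. z ^ (p + 2 ^ k))"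
    by (rule sum.reindex_bij_witness[where i = "\<lambda>p. p + 2 ^ k" and j = "\<lambda>p. p - 2 ^ k"])
       (use assms in \<open>auto simp: T_def\<close>)
  also have "\<dots> = z ^ (2 ^ k) * (\<Sum>p<Suc m - 2 ^ k. z ^ p)"
    by (simp add: sum_distrib_left power_add mult.commute)
  also have "cmod \<dots> = cmod (\<Sum>p<Suc m - 2 ^ k. z ^ p)"
    by (simp add: norm_mult norm_power z)
  also have "\<dots> \<le> 32 * (\<Sum>j\<le>k. (norm (\<Sum>n<2 ^ j. z ^ n))\<^sup>2 / 2 ^ j)"
    by (rule geometric_sum_le_fejer[OF z]) (use assms in simp)
  finally show ?thesis by (simp add: z_def torus_char_power)
qed


section \<open>The maximal function of a dyadic block\<close>

text \<open>
  Both sides are double integrals of the two kernels in the hypothesis: \<open>|\<integral> g|\<^sup>2\<close> is the iterated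
  integral of \<open>g(x) cnj g(y)\<close>. As the kernels are finite sums of products, linearity of the integral
  takes the place of Fubini's theorem.
\<close>

lemma sum_norm_integral_le_of_kernel_le:
  fixes g :: "'i \<Rightarrow> 'a \<Rightarrow> complex" and \<phi> :: "'j \<Rightarrow> 'a \<Rightarrow> complex" and w :: "'j \<Rightarrow> real"
  assumes g: "\<And>n. n \<in> I \<Longrightarrow> integrable M (g n)"
    and \<phi>: "\<And>i. i \<in> A \<Longrightarrow> integrable M (\<phi> i)"
    and le: "\<And>x y. x \<in> space M \<Longrightarrow> y \<in> space M \<Longrightarrow>
       cmod (\<Sum>n\<in>I. g n x * cnj (g n y)) \<le> Re (\<Sum>i\<in>A. of_real (w i) * (\<phi> i x * cnj (\<phi> i y)))"
  shows "(\<Sum>n\<in>I. (cmod (LINT x|M. g n x))\<^sup>2) \<le> (\<Sum>i\<in>A. w i * (cmod (LINT x|M. \<phi> i x))\<^sup>2)"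
proof -
  define G where "G n = (LINT y|M. g n y)" for n
  define \<Phi> where "\<Phi> i = (LINT y|M. \<phi> i y)" for i
  have inner: "cmod (\<Sum>n\<in>I. g n x * cnj (G n))
      \<le> Re (\<Sum>i\<in>A. of_real (w i) * (\<phi> i x * cnj (\<Phi> i)))" if x: "x \<in> space M" for x
  proof -
    have "(\<Sum>n\<in>I. g n x * cnj (G n)) = (LINT y|M. (\<Sum>n\<in>I. g n x * cnj (g n y)))"
      using g by (simp add: G_def)
    also have "cmod \<dots> \<le> (LINT y|M. cmod (\<Sum>n\<in>I. g n x * cnj (g n y)))"
      by (rule integral_norm_bound)
    also have "\<dots> \<le> (LINT y|M. Re (\<Sum>i\<in>A. of_real (w i) * (\<phi> i x * cnj (\<phi> i y))))"
      by (rule integral_mono) (use g \<phi> le[OF x] in auto)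
    also have "\<dots> = Re (LINT y|M. (\<Sum>i\<in>A. of_real (w i) * (\<phi> i x * cnj (\<phi> i y))))"
      by (rule integral_Re) (use \<phi> in auto)
    also have "(LINT y|M. (\<Sum>i\<in>A. of_real (w i) * (\<phi> i x * cnj (\<phi> i y))))
        = (\<Sum>i\<in>A. of_real (w i) * (\<phi> i x * cnj (\<Phi> i)))"
      using \<phi> by (simp add: \<Phi>_def)
    finally show ?thesis .
  qed
  have "complex_of_real (\<Sum>n\<in>I. (cmod (G n))\<^sup>2) = (LINT x|M. (\<Sum>n\<in>I. g n x * cnj (G n)))"
    using g by (simp add: G_def complex_norm_square del: of_real_power)
  from arg_cong[OF this, of cmod]
  have "(\<Sum>n\<in>I. (cmod (G n))\<^sup>2) = cmod (LINT x|M. (\<Sum>n\<in>I. g n x * cnj (G n)))"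
    by (simp only: norm_of_real abs_of_nonneg[OF sum_nonneg[OF zero_le_power2]])
  also have "\<dots> \<le> (LINT x|M. cmod (\<Sum>n\<in>I. g n x * cnj (G n)))"
    by (rule integral_norm_bound)
  also have "\<dots> \<le> (LINT x|M. Re (\<Sum>i\<in>A. of_real (w i) * (\<phi> i x * cnj (\<Phi> i))))"
    by (rule integral_mono) (use g \<phi> inner in auto)
  also have "\<dots> = Re (LINT x|M. (\<Sum>i\<in>A. of_real (w i) * (\<phi> i x * cnj (\<Phi> i))))"
    by (rule integral_Re) (use \<phi> in auto)
  also have "(LINT x|M. (\<Sum>i\<in>A. of_real (w i) * (\<phi> i x * cnj (\<Phi> i))))
      = of_real (\<Sum>i\<in>A. w i * (cmod (\<Phi> i))\<^sup>2)"
    using \<phi> by (simp add: \<Phi>_def complex_norm_square del: of_real_power)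
  finally show ?thesis by (simp add: G_def \<Phi>_def)
qed

text \<open>
  The double integral, in \<open>x\<close> and \<open>y\<close>, of the majorant of \<open>sum_torus_char_freq_block_upto\<close> at the
  point \<open>x - y\<close>, with the squared moduli multiplied out.
\<close>

definition fejer_energy :: "real measure \<Rightarrow> nat \<Rightarrow> real" where
  "fejer_energy \<mu> k = (\<Sum>j\<le>k. \<Sum>a<2 ^ j. \<Sum>b<2 ^ j.
      64 / 2 ^ j * (cmod (fourier_measure \<mu> (int a - int b)))\<^sup>2)"

text \<open>
  The truncation may depend measurably on the point, which is what linearises a maximal function.
  The bound does not see \<open>m\<close>, because two truncations \<open>m x\<close> and \<open>m y\<close> interact only through
  the truncation at their minimum, and the Fejer majorant is the same for all truncations.
\<close>

lemma integral_truncated_block_le: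
  fixes c :: "int \<Rightarrow> complex"
  assumes "prob_space \<mu>"
    and char [measurable]: "\<And>n. torus_char n \<in> borel_measurable \<mu>"
    and m [measurable]: "m \<in> \<mu> \<rightarrow>\<^sub>M count_space UNIV"
    and m_ge: "\<And>x. 2 ^ k \<le> m x" and m_less: "\<And>x. m x < 2 ^ Suc k"
  shows "integrable \<mu> (\<lambda>x. cmod (\<Sum>n\<in>freq_block_upto k (m x). c n * torus_char n x))"
    and "(LINT x|\<mu>. cmod (\<Sum>n\<in>freq_block_upto k (m x). c n * torus_char n x))
         \<le> sqrt (\<Sum>n\<in>freq_block k. (cmod (c n))\<^sup>2) * sqrt (fejer_energy \<mu> k)"
proof -
  interpret prob_space \<mu> by fact
  define J where "J = (\<lambda>x. freq_block_upto k (m x))"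
  define T where "T = (\<lambda>x. \<Sum>n\<in>freq_block k. of_bool (n \<in> J x) * (c n * torus_char n x))"
  define g where "g = (\<lambda>n x. cnj (sgn (T x)) * (of_bool (n \<in> J x) * torus_char n x))"
  have J_subset: "J x \<subseteq> freq_block k" for x
    unfolding J_def by (rule freq_block_upto_subset[OF m_less])
  have sum_J: "(\<Sum>n\<in>freq_block k. of_bool (n \<in> J x) * h n) = (\<Sum>n\<in>J x. h n)" for x and h :: "int \<Rightarrow> complex"
    using J_subset[of x] by (simp add: sum.inter_restrict[symmetric] Int_absorb1 if_distrib[where f="\<lambda>u. u * _"] of_bool_def cong: if_cong)
  have T_eq: "T x = (\<Sum>n\<in>freq_block_upto k (m x). c n * torus_char n x)" for x
    using sum_J[of x "\<lambda>n. c n * torus_char n x"] by (simp add: T_def J_def)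
  have [measurable]: "(\<lambda>x. of_bool (n \<in> J x) :: complex) \<in> borel_measurable \<mu>" for n
    unfolding J_def by (rule measurable_compose[OF m]) simp
  have T_meas [measurable]: "T \<in> borel_measurable \<mu>"
    unfolding T_def by measurable
  have [measurable]: "(\<lambda>x. cnj (sgn (T x))) \<in> borel_measurable \<mu>"
    unfolding sgn_div_norm by (rule borel_measurable_continuous_on[of cnj]) (auto intro: continuous_intros)
  have g_meas [measurable]: "g n \<in> borel_measurable \<mu>" for n
    unfolding g_def by measurable
  have cnj_of_bool [simp]: "cnj (of_bool P) = of_bool P" for P
    by (cases P) auto
  have sgn_le: "cmod (sgn u) \<le> 1" for u
    by (simp add: norm_sgn)
  have g_int: "integrable \<mu> (g n)" for n
    by (rule integrable_const_bound[where B = 1])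
       (auto simp: g_def norm_mult sgn_le)
  have char_int: "integrable \<mu> (torus_char n)" for n
    by (rule integrable_const_bound[where B = 1]) auto
  have norm_T: "of_real (cmod (T x)) = (\<Sum>n\<in>freq_block k. c n * g n x)" for x
  proof -
    have "(\<Sum>n\<in>freq_block k. c n * g n x) = cnj (sgn (T x)) * T x"
      unfolding g_def by (subst (3) T_def) (simp add: sum_distrib_left mult_ac)
    also have "\<dots> = of_real (cmod (T x))"
      by (cases "T x = 0")
         (simp_all add: sgn_div_norm scaleR_conv_of_real complex_norm_square[symmetric]
           power2_eq_square field_simps)
    finally show ?thesis by simp
  qed
  have "integrable \<mu> (\<lambda>x. Re (\<Sum>n\<in>freq_block k. c n * g n x))"
    using g_int by auto
  then have T_int: "integrable \<mu> (\<lambda>x. cmod (T x))"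
    by (simp flip: norm_T)
  then show "integrable \<mu> (\<lambda>x. cmod (\<Sum>n\<in>freq_block_upto k (m x). c n * torus_char n x))"
    by (simp add: T_eq)
  \<comment> \<open>The index \<open>(j, a, b)\<close> stands for the term \<open>e(a(x-y)) cnj e(b(x-y))\<close> of the Fejer kernel of
    order \<open>2^j\<close>, which is the product of a function of \<open>x\<close> and its conjugate in \<open>y\<close>.\<close>
  define A where "A = (SIGMA j:{..k}. {..<(2 ^ j) :: nat} \<times> {..<(2 ^ j) :: nat})"
  have kernel: "cmod (\<Sum>n\<in>freq_block k. g n x * cnj (g n y))
      \<le> Re (\<Sum>(j, a, b)\<in>A. of_real (64 / 2 ^ j) *
            (torus_char (int a - int b) x * cnj (torus_char (int a - int b) y)))" for x y
  proof -
    have "(\<Sum>n\<in>freq_block k. g n x * cnj (g n y))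
       = cnj (sgn (T x)) * sgn (T y) *
         (\<Sum>n\<in>freq_block k. of_bool (n \<in> J x) * (of_bool (n \<in> J y) * torus_char n (x - y)))"
      by (simp add: g_def sum_distrib_left mult_ac torus_char_arg_diff)
    also have "(\<Sum>n\<in>freq_block k. of_bool (n \<in> J x) * (of_bool (n \<in> J y) * torus_char n (x - y)))
        = (\<Sum>n\<in>freq_block_upto k (min (m x) (m y)). torus_char n (x - y))"
      unfolding sum_J freq_block_upto_Int[symmetric]
      by (simp add: J_def sum.inter_restrict of_bool_def if_distrib[where f="\<lambda>u. u * _"] cong: if_cong)
    also have "cmod (cnj (sgn (T x)) * sgn (T y) * \<dots>) \<le> 1 * 1 * cmod \<dots>"
      unfolding norm_mult complex_mod_cnj by (intro mult_mono sgn_le) auto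
    also have "1 * 1 * cmod (\<Sum>n\<in>freq_block_upto k (min (m x) (m y)). torus_char n (x - y))
       \<le> 64 * (\<Sum>j\<le>k. (cmod (\<Sum>n<2 ^ j. torus_char (int n) (x - y)))\<^sup>2 / 2 ^ j)"
      using sum_torus_char_freq_block_upto[of k "min (m x) (m y)" "x - y"] m_ge m_less
      by (simp add: min_def)
    also have "\<dots> = Re (complex_of_real \<dots>)" by simp
    also have "complex_of_real (64 * (\<Sum>j\<le>k. (cmod (\<Sum>n<2 ^ j. torus_char (int n) (x - y)))\<^sup>2 / 2 ^ j))
       = (\<Sum>j\<le>k. of_real (64 / 2 ^ j) *
           of_real ((cmod (\<Sum>n<2 ^ j. torus_char (int n) (x - y)))\<^sup>2))"
      by (simp add: sum_distrib_left)
    also have "\<dots> = (\<Sum>j\<le>k. \<Sum>a<2 ^ j. \<Sum>b<2 ^ j. of_real (64 / 2 ^ j) *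
            (torus_char (int a - int b) x * cnj (torus_char (int a - int b) y)))"
      unfolding complex_norm_square cnj_sum sum_product unfolding sum_distrib_left
      by (simp add: torus_char_diff torus_char_arg_diff mult_ac)
    also have "\<dots> = (\<Sum>(j, a, b)\<in>A. of_real (64 / 2 ^ j) *
            (torus_char (int a - int b) x * cnj (torus_char (int a - int b) y)))"
      by (simp add: A_def sum.Sigma sum.cartesian_product split_def)
    finally show ?thesis .
  qed
  have "(\<Sum>n\<in>freq_block k. (cmod (LINT x|\<mu>. g n x))\<^sup>2)
     \<le> (\<Sum>i\<in>A. (case i of (j, a, b) \<Rightarrow> 64 / 2 ^ j) *
         (cmod (LINT x|\<mu>. (case i of (j, a, b) \<Rightarrow> torus_char (int a - int b)) x))\<^sup>2)"
    by (rule sum_norm_integral_le_of_kernel_le)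
       (use g_int char_int kernel in \<open>auto simp: split_def\<close>)
  also have "\<dots> = fejer_energy \<mu> k"
    by (simp add: A_def fejer_energy_def fourier_measure_def sum.Sigma sum.cartesian_product split_def)
  finally have energy: "(\<Sum>n\<in>freq_block k. (cmod (LINT x|\<mu>. g n x))\<^sup>2) \<le> fejer_energy \<mu> k" .
  have "of_real (LINT x|\<mu>. cmod (T x)) = (\<Sum>n\<in>freq_block k. c n * (LINT x|\<mu>. g n x))"
  proof -
    have "complex_of_real (LINT x|\<mu>. cmod (T x)) = (LINT x|\<mu>. (\<Sum>n\<in>freq_block k. c n * g n x))"
      unfolding norm_T[symmetric] by simp
    then show ?thesis using g_int by simp
  qed
  then have "(LINT x|\<mu>. cmod (T x)) \<le> cmod (\<Sum>n\<in>freq_block k. c n * (LINT x|\<mu>. g n x))"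
    by (metis abs_ge_self norm_of_real)
  also have "\<dots> \<le> (\<Sum>n\<in>freq_block k. cmod (c n) * cmod (LINT x|\<mu>. g n x))"
    by (rule sum_norm_le) (simp add: norm_mult)
  also have "\<dots> \<le> L2_set (\<lambda>n. cmod (c n)) (freq_block k) * L2_set (\<lambda>n. cmod (LINT x|\<mu>. g n x)) (freq_block k)"
    using L2_set_mult_ineq[of "\<lambda>n. cmod (c n)" "\<lambda>n. cmod (LINT x|\<mu>. g n x)" "freq_block k"] by simp
  also have "\<dots> \<le> sqrt (\<Sum>n\<in>freq_block k. (cmod (c n))\<^sup>2) * sqrt (fejer_energy \<mu> k)"
    unfolding L2_set_def using energy by (intro mult_left_mono) (auto intro: sum_nonneg)
  finally show "(LINT x|\<mu>. cmod (\<Sum>n\<in>freq_block_upto k (m x). c n * torus_char n x))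
         \<le> sqrt (\<Sum>n\<in>freq_block k. (cmod (c n))\<^sup>2) * sqrt (fejer_energy \<mu> k)"
    by (simp add: T_eq)
qed

definition block_max :: "(int \<Rightarrow> complex) \<Rightarrow> nat \<Rightarrow> real \<Rightarrow> real" where
  "block_max c k x =
     Max ((\<lambda>m. cmod (\<Sum>n\<in>freq_block_upto k m. c n * torus_char n x)) ` {2 ^ k..<2 ^ Suc k})"

lemma block_max_ge:
  assumes "2 ^ k \<le> m" and "m < 2 ^ Suc k"
  shows "cmod (\<Sum>n\<in>freq_block_upto k m. c n * torus_char n x) \<le> block_max c k x"
  unfolding block_max_def by (rule Max_ge) (use assms in auto)

lemma block_max_nonneg: "0 \<le> block_max c k x"
  using order_trans[OF norm_ge_zero block_max_ge[of k "2 ^ k"]] by simp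

lemma integral_block_max_le:
  assumes "prob_space \<mu>"
    and char [measurable]: "\<And>n. torus_char n \<in> borel_measurable \<mu>"
  shows "integrable \<mu> (block_max c k)"
    and "(LINT x|\<mu>. block_max c k x)
         \<le> sqrt (\<Sum>n\<in>freq_block k. (cmod (c n))\<^sup>2) * sqrt (fejer_energy \<mu> k)"
proof -
  define S where "S = (\<lambda>m x. cmod (\<Sum>n\<in>freq_block_upto k m. c n * torus_char n x))"
  define P where "P = (\<lambda>x m. m \<in> {2 ^ k..<2 ^ Suc k} \<and> S m x = block_max c k x)"
  \<comment> \<open>Among the truncations attaining the maximum, the least one depends measurably on \<open>x\<close>.\<close>
  define m where "m = (\<lambda>x. LEAST m. P x m)"
  have S_meas [measurable]: "S m \<in> borel_measurable \<mu>" for m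
    unfolding S_def by measurable
  have [measurable]: "block_max c k \<in> borel_measurable \<mu>"
    unfolding block_max_def S_def[symmetric] by (rule borel_measurable_Max) auto
  have m_meas: "m \<in> \<mu> \<rightarrow>\<^sub>M count_space UNIV"
    unfolding m_def P_def by measurable
  have "P x (m x)" for x
  proof -
    have "block_max c k x \<in> (\<lambda>m. S m x) ` {2 ^ k..<2 ^ Suc k}"
      unfolding block_max_def S_def by (rule Max_in) auto
    then have "\<exists>m. P x m" by (auto simp: P_def)
    then show ?thesis unfolding m_def by (rule LeastI_ex)
  qed
  then have bounds: "2 ^ k \<le> m x" "m x < 2 ^ Suc k" and eq: "S (m x) x = block_max c k x" for x
    by (auto simp: P_def)
  show "integrable \<mu> (block_max c k)"
    using integral_truncated_block_le(1)[OF assms m_meas bounds, of c] eq by (simp add: S_def)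
  show "(LINT x|\<mu>. block_max c k x)
         \<le> sqrt (\<Sum>n\<in>freq_block k. (cmod (c n))\<^sup>2) * sqrt (fejer_energy \<mu> k)"
    using integral_truncated_block_le(2)[OF assms m_meas bounds, of c] eq by (simp add: S_def)
qed


section \<open>Energy estimates from Fourier decay\<close>

lemma sum_fourier_measure_row_le:
  assumes "a < M"
  shows "(\<Sum>b<M. (cmod (fourier_measure \<mu> (int a - int b)))\<^sup>2)
       \<le> 2 * (\<Sum>d<M. (cmod (fourier_measure \<mu> (int d)))\<^sup>2)"
proof -
  define h where "h d = (cmod (fourier_measure \<mu> (int d)))\<^sup>2" for d
  have sym: "(cmod (fourier_measure \<mu> (- n)))\<^sup>2 = (cmod (fourier_measure \<mu> n))\<^sup>2" for n
    by (simp add: fourier_measure_uminus)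
  have neg: "(cmod (fourier_measure \<mu> (int a - int b)))\<^sup>2 = h (b - a)" if "a \<le> b" for b
    using sym[of "int (b - a)"] that by (simp add: h_def of_nat_diff)
  have split: "{..<M} = {..a} \<union> {Suc a..<M}" using assms by auto
  have "(\<Sum>b<M. (cmod (fourier_measure \<mu> (int a - int b)))\<^sup>2)
     = (\<Sum>b\<le>a. (cmod (fourier_measure \<mu> (int a - int b)))\<^sup>2)
     + (\<Sum>b=Suc a..<M. (cmod (fourier_measure \<mu> (int a - int b)))\<^sup>2)"
    unfolding split by (rule sum.union_disjoint) auto
  also have "(\<Sum>b\<le>a. (cmod (fourier_measure \<mu> (int a - int b)))\<^sup>2) = (\<Sum>d\<le>a. h d)"
    by (rule sum.reindex_bij_witness[where i = "\<lambda>d. a - d" and j = "\<lambda>b. a - b"])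
       (auto simp: h_def of_nat_diff)
  also have "\<dots> \<le> (\<Sum>d<M. h d)"
    by (rule sum_mono2) (use assms in \<open>auto simp: h_def\<close>)
  also have "(\<Sum>b=Suc a..<M. (cmod (fourier_measure \<mu> (int a - int b)))\<^sup>2) = (\<Sum>d=1..<M - a. h d)"
    by (rule sum.reindex_bij_witness[where i = "\<lambda>d. d + a" and j = "\<lambda>b. b - a"])
       (auto simp: neg)
  also have "\<dots> \<le> (\<Sum>d<M. h d)"
    by (rule sum_mono2) (auto simp: h_def)
  finally show ?thesis by (simp add: h_def)
qed

text \<open>
  Inserting \<open>1 \<le> (d+1) powr - \<gamma> * (2 powr \<gamma>)^j\<close> for \<open>d < 2^j\<close> bounds
  \<open>\<Sum>d<2^j. |\<mu>^(d)|\<^sup>2\<close> by a multiple of \<open>(2 powr \<gamma>)^j\<close>. In the \<open>j\<close>-th Fejer kernel each of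
  the \<open>2^j\<close> rows is at most twice that sum, which cancels the normalisation \<open>1 / 2^j\<close>; what is left
  is a geometric series in \<open>j\<close>.
\<close>

lemma fejer_energy_le:
  fixes \<gamma> :: real
  assumes \<gamma>: "0 < \<gamma>"
    and summ: "summable (\<lambda>d. (cmod (fourier_measure \<mu> (int d)))\<^sup>2 * real (Suc d) powr (- \<gamma>))"
  shows "\<exists>C\<ge>0. \<forall>k. fejer_energy \<mu> k \<le> C * (2 powr \<gamma>) ^ k"
proof -
  define h where "h d = (cmod (fourier_measure \<mu> (int d)))\<^sup>2" for d
  define A where "A = (\<Sum>d. h d * real (Suc d) powr (- \<gamma>))"
  define r where "r = 2 powr \<gamma>"
  have r: "1 < r" using \<gamma> by (simp add: r_def)
  have A0: "0 \<le> A"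
    unfolding A_def by (rule suminf_nonneg) (use summ in \<open>auto simp: h_def\<close>)
  have h_sum: "(\<Sum>d<2 ^ j. h d) \<le> A * r ^ j" for j
  proof -
    have "(\<Sum>d<2 ^ j. h d) \<le> (\<Sum>d<2 ^ j. h d * real (Suc d) powr (- \<gamma>) * r ^ j)"
    proof (rule sum_mono)
      fix d :: nat assume "d \<in> {..<2 ^ j}"
      then have "real (Suc d) \<le> real (2 ^ j)"
        by (subst of_nat_le_iff) simp
      then have "real (Suc d) \<le> 2 ^ j"
        by simp
      then have "real (Suc d) powr \<gamma> \<le> (2 ^ j) powr \<gamma>"
        by (rule powr_mono2[rotated 2]) (use \<gamma> in auto)
      also have "\<dots> = r ^ j"
        by (simp add: r_def powr_realpow[symmetric] powr_powr mult.commute)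
      finally have "1 \<le> real (Suc d) powr (- \<gamma>) * r ^ j"
        by (simp add: powr_minus field_simps)
      then show "h d \<le> h d * real (Suc d) powr (- \<gamma>) * r ^ j"
        using mult_left_mono[of 1 "real (Suc d) powr (- \<gamma>) * r ^ j" "h d"]
        by (simp add: h_def mult.assoc)
    qed
    also have "\<dots> = (\<Sum>d<2 ^ j. h d * real (Suc d) powr (- \<gamma>)) * r ^ j"
      by (simp add: sum_distrib_right)
    also have "\<dots> \<le> A * r ^ j"
      unfolding A_def using r summ
      by (intro mult_right_mono sum_le_suminf) (auto simp: h_def)
    finally show ?thesis .
  qed
  have "fejer_energy \<mu> k \<le> 128 * A * r / (r - 1) * r ^ k" for k
  proof -
    have "fejer_energy \<mu> k \<le> (\<Sum>j\<le>k. 128 * A * r ^ j)"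
      unfolding fejer_energy_def
    proof (rule sum_mono)
      fix j assume "j \<in> {..k}"
      have "(\<Sum>a<2 ^ j. \<Sum>b<2 ^ j. 64 / 2 ^ j * (cmod (fourier_measure \<mu> (int a - int b)))\<^sup>2)
          = 64 / 2 ^ j * (\<Sum>a<2 ^ j. \<Sum>b<2 ^ j. (cmod (fourier_measure \<mu> (int a - int b)))\<^sup>2)"
        by (simp add: sum_distrib_left)
      also have "\<dots> \<le> 64 / 2 ^ j * (\<Sum>a<(2::nat) ^ j. 2 * (A * r ^ j))"
      proof (intro mult_left_mono sum_mono)
        fix a :: nat assume "a \<in> {..<2 ^ j}"
        then show "(\<Sum>b<2 ^ j. (cmod (fourier_measure \<mu> (int a - int b)))\<^sup>2) \<le> 2 * (A * r ^ j)"
          using sum_fourier_measure_row_le[of a "2 ^ j" \<mu>] h_sum[of j] by (simp add: h_def)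
      qed auto
      also have "\<dots> = 128 * A * r ^ j" by simp
      finally show "(\<Sum>a<2 ^ j. \<Sum>b<2 ^ j. 64 / 2 ^ j *
          (cmod (fourier_measure \<mu> (int a - int b)))\<^sup>2) \<le> 128 * A * r ^ j" .
    qed
    also have "\<dots> = 128 * A * ((r ^ Suc k - 1) / (r - 1))"
      using r by (subst geometric_sum[symmetric]) (auto simp: sum_distrib_left lessThan_Suc_atMost)
    also have "\<dots> \<le> 128 * A * (r ^ Suc k / (r - 1))"
      using r A0 by (intro mult_left_mono divide_right_mono) auto
    finally show ?thesis by simp
  qed
  moreover have "0 \<le> 128 * A * r / (r - 1)" using A0 r by simp
  ultimately show ?thesis unfolding r_def by blast
qed

lemma summable_energy_of_smallo:
  fixes \<alpha> \<gamma> :: real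
  assumes decay: "(\<lambda>u::int. (cmod (fourier_measure \<mu> u))\<^sup>2)
          \<in> o[filtercomap (\<lambda>u. \<bar>u\<bar>) at_top](\<lambda>u. \<bar>real_of_int u\<bar> powr (- \<alpha>))"
    and \<gamma>: "0 \<le> \<gamma>" "1 < \<alpha> + \<gamma>"
  shows "summable (\<lambda>d. (cmod (fourier_measure \<mu> (int d)))\<^sup>2 * real (Suc d) powr (- \<gamma>))"
proof -
  have "eventually (\<lambda>u::int. norm ((cmod (fourier_measure \<mu> u))\<^sup>2)
      \<le> 1 * norm (\<bar>real_of_int u\<bar> powr (- \<alpha>))) (filtercomap (\<lambda>u. \<bar>u\<bar>) at_top)"
    by (rule landau_o.smallD[OF decay]) simp
  then obtain U where U: "\<And>u::int. U \<le> \<bar>u\<bar> \<Longrightarrow> (cmod (fourier_measure \<mu> u))\<^sup>2 \<le> \<bar>real_of_int u\<bar> powr (- \<alpha>)"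
    unfolding eventually_filtercomap eventually_at_top_linorder by auto
  show ?thesis
  proof (rule summable_comparison_test_ev)
    show "summable (\<lambda>d. real d powr (- (\<alpha> + \<gamma>)))"
      using \<gamma> by (simp add: summable_real_powr_iff)
    show "eventually (\<lambda>d. norm ((cmod (fourier_measure \<mu> (int d)))\<^sup>2 * real (Suc d) powr (- \<gamma>))
        \<le> real d powr (- (\<alpha> + \<gamma>))) sequentially"
      using eventually_ge_at_top[of "max 1 (nat U)"]
    proof eventually_elim
      case (elim d)
      then have d: "1 \<le> d" "U \<le> \<bar>int d\<bar>" by auto
      have "(cmod (fourier_measure \<mu> (int d)))\<^sup>2 * real (Suc d) powr (- \<gamma>)
          \<le> real d powr (- \<alpha>) * real d powr (- \<gamma>)"
        using U[OF d(2)] d \<gamma> by (intro mult_mono powr_mono2') auto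
      also have "\<dots> = real d powr (- (\<alpha> + \<gamma>))"
        by (simp add: powr_add[symmetric])
      finally show ?case by simp
    qed
  qed
qed


section \<open>Convergence of the partial sums\<close>

lemma partial_sum_add_block:
  assumes "2 ^ k \<le> N"
  shows "(\<Sum>n | \<bar>n\<bar> \<le> int N. F n) =
     (\<Sum>n | \<bar>n\<bar> \<le> int (2 ^ k - 1). F n) + (\<Sum>n\<in>freq_block_upto k N. F n :: complex)"
proof -
  have fin: "finite {n. \<bar>n\<bar> \<le> int K}" for K
    by (rule finite_subset[of _ "{- int K..int K}"]) auto
  have pow: "int (2 ^ k - 1) = 2 ^ k - 1" by (simp add: of_nat_diff)
  have "(2::int) ^ k \<le> int N" using assms by simp
  then have un: "{n. \<bar>n\<bar> \<le> int N} = {n. \<bar>n\<bar> \<le> int (2 ^ k - 1)} \<union> freq_block_upto k N"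
    unfolding pow freq_block_upto_def by (auto simp del: numeral_power_le_of_nat_cancel_iff)
  have disj: "{n. \<bar>n\<bar> \<le> int (2 ^ k - 1)} \<inter> freq_block_upto k N = {}"
    unfolding pow freq_block_upto_def by auto
  show ?thesis unfolding un using fin finite_freq_block_upto disj by (rule sum.union_disjoint)
qed

text \<open>
  The maximal function of block \<open>k\<close> controls both the jump between consecutive dyadic partial sums and
  the oscillation of the partial sums in between.
\<close>

lemma convergent_partial_sum_of_summable_block_max:
  assumes "summable (\<lambda>k. block_max c k t)"
  shows "convergent (\<lambda>N. \<Sum>n | \<bar>n\<bar> \<le> int N. c n * torus_char n t)"
proof -
  define S where "S = (\<lambda>N. \<Sum>n | \<bar>n\<bar> \<le> int N. c n * torus_char n t)"
  \<comment> \<open>Blocks start at \<open>2^k\<close>, so the dyadic partial sums stop at \<open>2^k - 1\<close>.\<close>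
  define V where "V = (\<lambda>k. S (2 ^ k - 1))"
  have near: "cmod (S N - V k) \<le> block_max c k t" if "2 ^ k \<le> N" "N < 2 ^ Suc k" for N k
    using block_max_ge[OF that, of c t] partial_sum_add_block[OF that(1)] by (simp add: S_def V_def)
  have "cmod (V (Suc k) - V k) \<le> block_max c k t" for k
    using near[of k "2 ^ Suc k - 1"] by (simp add: V_def)
  then have "summable (\<lambda>k. V (Suc k) - V k)"
    by (intro summable_comparison_test'[OF assms, of 0]) auto
  then have "convergent V"
    by (simp add: summable_iff_convergent sum_lessThan_telescope convergent_diff_const_right_iff)
  then obtain l where l: "V \<longlonglongrightarrow> l" by (auto simp: convergent_def)
  have "S \<longlonglongrightarrow> l"
  proof (rule LIMSEQ_I)
    fix e :: real assume "0 < e"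
    then have "0 < e / 2" by simp
    from LIMSEQ_D[OF l this] obtain K1 where K1: "\<And>k. K1 \<le> k \<Longrightarrow> norm (V k - l) < e / 2" by auto
    from LIMSEQ_D[OF summable_LIMSEQ_zero[OF assms] \<open>0 < e / 2\<close>]
    obtain K2 where K2: "\<And>k. K2 \<le> k \<Longrightarrow> block_max c k t < e / 2"
      by (auto simp: abs_of_nonneg[OF block_max_nonneg])
    have "norm (S N - l) < e" if N: "2 ^ max K1 K2 \<le> N" for N
    proof -
      have "1 \<le> N" using N by (metis le_trans one_le_numeral one_le_power)
      then obtain k where k: "2 ^ k \<le> N" "N < 2 ^ (k + 1)"
        using ex_power_ivl1[of 2 N] by auto
      have "(2::nat) ^ max K1 K2 < 2 ^ (k + 1)" using N k by linarith
      then have "max K1 K2 < k + 1" by (rule power_less_imp_less_exp[rotated]) simp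
      then have "norm (V k - l) < e / 2" "block_max c k t < e / 2" using K1 K2 by auto
      then show ?thesis
        using near[of k N] k norm_triangle_ineq[of "S N - V k" "V k - l"] by simp
    qed
    then show "\<exists>N0. \<forall>N\<ge>N0. norm (S N - l) < e" by blast
  qed
  then show ?thesis unfolding S_def convergent_def by blast
qed

lemma AE_convergent_of_energy:
  fixes c :: "int \<Rightarrow> complex" and \<gamma> b B :: real
  assumes "prob_space \<mu>"
    and char: "\<And>n. torus_char n \<in> borel_measurable \<mu>"
    and \<gamma>: "0 < \<gamma>" "\<gamma> < 2 * b"
    and energy: "summable (\<lambda>d. (cmod (fourier_measure \<mu> (int d)))\<^sup>2 * real (Suc d) powr (- \<gamma>))"
    and coeff: "\<And>k. (\<Sum>n\<in>freq_block k. (cmod (c n))\<^sup>2) \<le> B * (2 powr (- 2 * b)) ^ k"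
  shows "AE t in \<mu>. convergent (\<lambda>N. \<Sum>n | \<bar>n\<bar> \<le> int N. c n * torus_char n t)"
proof -
  obtain C where C: "0 \<le> C" "\<And>k. fejer_energy \<mu> k \<le> C * (2 powr \<gamma>) ^ k"
    using fejer_energy_le[OF \<gamma>(1) energy] by auto
  define \<rho> where "\<rho> = sqrt (2 powr (- 2 * b) * 2 powr \<gamma>)"
  have \<rho>: "0 \<le> \<rho>" "\<rho> < 1"
    using \<gamma> by (auto simp: \<rho>_def powr_add[symmetric] powr_less_one)
  have "0 \<le> (\<Sum>n\<in>freq_block 0. (cmod (c n))\<^sup>2)" by (rule sum_nonneg) simp
  then have B: "0 \<le> B" using coeff[of 0] by simp
  have int_le: "(LINT t|\<mu>. block_max c k t) \<le> sqrt (B * C) * \<rho> ^ k" for k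
  proof -
    have "(LINT t|\<mu>. block_max c k t)
        \<le> sqrt (\<Sum>n\<in>freq_block k. (cmod (c n))\<^sup>2) * sqrt (fejer_energy \<mu> k)"
      by (rule integral_block_max_le) fact+
    also have "\<dots> \<le> sqrt (B * (2 powr (- 2 * b)) ^ k) * sqrt (C * (2 powr \<gamma>) ^ k)"
      using coeff[of k] C(2)[of k] B C(1)
      by (intro mult_mono real_sqrt_le_mono) (auto simp: fejer_energy_def intro!: sum_nonneg)
    also have "\<dots> = sqrt (B * C) * \<rho> ^ k"
      by (simp add: \<rho>_def real_sqrt_mult real_sqrt_power power_mult_distrib)
    finally show ?thesis .
  qed
  have "summable (\<lambda>k. sqrt (B * C) * \<rho> ^ k)"
    using \<rho> by (intro summable_mult summable_geometric) auto
  then have summ: "summable (\<lambda>k. LINT t|\<mu>. block_max c k t)"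
    by (rule summable_comparison_test'[where N = 0])
       (use int_le in \<open>auto simp: block_max_nonneg\<close>)
  have integr: "integrable \<mu> (block_max c k)" for k
    by (rule integral_block_max_le) fact+
  then have meas [measurable]: "block_max c k \<in> borel_measurable \<mu>" for k by blast
  have "(\<integral>\<^sup>+t. (\<Sum>k. ennreal (block_max c k t)) \<partial>\<mu>) = (\<Sum>k. \<integral>\<^sup>+t. ennreal (block_max c k t) \<partial>\<mu>)"
    by (rule nn_integral_suminf) simp
  also have "\<dots> = (\<Sum>k. ennreal (LINT t|\<mu>. block_max c k t))"
    by (simp add: nn_integral_eq_integral[OF integr] block_max_nonneg)
  also have "\<dots> \<noteq> \<infinity>"
    by (subst suminf_ennreal_eq[OF _ summable_sums[OF summ]]) (auto simp: block_max_nonneg)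
  finally have "AE t in \<mu>. (\<Sum>k. ennreal (block_max c k t)) \<noteq> \<infinity>"
    by (intro nn_integral_PInf_AE) auto
  then show ?thesis
  proof eventually_elim
    case (elim t)
    then have "summable (\<lambda>k. block_max c k t)"
      by (intro summable_suminf_not_top) (auto simp: block_max_nonneg)
    then show ?case by (rule convergent_partial_sum_of_summable_block_max)
  qed
qed

text \<open>
  On block \<open>k\<close> the weight is at least \<open>2 powr (2bk)\<close>: the logarithm is at least \<open>1\<close> there, as
  \<open>|n| + 1 \<ge> 2\<close>.
\<close>

lemma sum_freq_block_le:
  fixes c :: "int \<Rightarrow> complex"
  assumes b: "0 \<le> b"
    and summ: "(\<lambda>n::int. (cmod (c n))\<^sup>2 * \<bar>real_of_int n\<bar> powr (2 * b)
            * (log 2 (\<bar>real_of_int n\<bar> + 1))\<^sup>2) summable_on UNIV"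
  shows "(\<Sum>n\<in>freq_block k. (cmod (c n))\<^sup>2)
     \<le> (\<Sum>\<^sub>\<infinity>n. (cmod (c n))\<^sup>2 * \<bar>real_of_int n\<bar> powr (2 * b)
            * (log 2 (\<bar>real_of_int n\<bar> + 1))\<^sup>2) * (2 powr (- 2 * b)) ^ k"
proof -
  define F where "F n = (cmod (c n))\<^sup>2 * \<bar>real_of_int n\<bar> powr (2 * b)
            * (log 2 (\<bar>real_of_int n\<bar> + 1))\<^sup>2" for n
  define q where "q = (2::real) powr (2 * b)"
  have q: "0 < q" by (simp add: q_def)
  have "q ^ k * (\<Sum>n\<in>freq_block k. (cmod (c n))\<^sup>2) = (\<Sum>n\<in>freq_block k. (cmod (c n))\<^sup>2 * q ^ k * 1)"
    by (simp add: sum_distrib_left mult.commute)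
  also have "\<dots> \<le> (\<Sum>n\<in>freq_block k. F n)"
    unfolding F_def
  proof (intro sum_mono mult_mono)
    fix n assume "n \<in> freq_block k"
    then have "2 ^ k \<le> \<bar>n\<bar>" by (simp add: freq_block_def)
    then have n: "2 ^ k \<le> \<bar>real_of_int n\<bar>"
      by (metis of_int_abs of_int_le_iff of_int_numeral of_int_power)
    have "q ^ k = (2 ^ k) powr (2 * b)"
      by (simp add: q_def powr_realpow[symmetric] powr_powr mult.commute)
    also have "\<dots> \<le> \<bar>real_of_int n\<bar> powr (2 * b)"
      using n b by (intro powr_mono2) auto
    finally show "q ^ k \<le> \<bar>real_of_int n\<bar> powr (2 * b)" .
    have "1 \<le> \<bar>real_of_int n\<bar>" using n by (meson one_le_numeral one_le_power order_trans)
    then have "1 \<le> log 2 (\<bar>real_of_int n\<bar> + 1)" by (subst le_log_iff) auto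
    then show "1 \<le> (log 2 (\<bar>real_of_int n\<bar> + 1))\<^sup>2" by (rule one_le_power)
  qed (use q in auto)
  also have "\<dots> \<le> (\<Sum>\<^sub>\<infinity>n. F n)"
    by (rule finite_sum_le_infsum) (use summ in \<open>auto simp: F_def\<close>)
  finally have "(\<Sum>n\<in>freq_block k. (cmod (c n))\<^sup>2) \<le> (\<Sum>\<^sub>\<infinity>n. F n) / q ^ k"
    using q by (simp add: pos_le_divide_eq mult.commute)
  then show ?thesis
    by (simp add: F_def q_def powr_minus power_inverse divide_inverse)
qed

theorem mainTheorem8:
  fixes b :: real and f :: "real \<Rightarrow> complex" and E :: "real set"
  assumes "0 \<le> b" and "b \<le> 1 / 2"
    and "f \<in> L2_torus"
    and "(\<lambda>n::int. (cmod (fourier_coeff f n))\<^sup>2 * \<bar>real_of_int n\<bar> powr (2 * b)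
            * (log 2 (\<bar>real_of_int n\<bar> + 1))\<^sup>2) summable_on UNIV"
    and "E \<in> sets torus_lebesgue"
    and "fourier_dim E > 1 - 2 * b"
  shows "\<exists>t\<in>E. convergent (\<lambda>N. fourier_partial_sum f N t)"
proof -
  define X where "X = {\<alpha>. 0 \<le> \<alpha> \<and> \<alpha> \<le> 1 \<and>
     (\<exists>\<mu>. supports_prob_measure E \<mu> \<and>
        (\<lambda>u::int. (cmod (fourier_measure \<mu> u))\<^sup>2)
          \<in> o[filtercomap (\<lambda>u. \<bar>u\<bar>) at_top](\<lambda>u. \<bar>real_of_int u\<bar> powr (- \<alpha>)))}"
  have "1 - 2 * b < Sup (insert 0 X)"
    using assms(6) by (simp add: fourier_dim_def X_def)
  moreover have "bdd_above (insert 0 X)"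
    by (rule bdd_aboveI[where M = 1]) (auto simp: X_def)
  ultimately have "\<exists>\<alpha>\<in>insert 0 X. 1 - 2 * b < \<alpha>"
    using less_cSup_iff[of "insert 0 X" "1 - 2 * b"] by blast
  then obtain \<alpha> where "\<alpha> \<in> insert 0 X" and \<alpha>: "1 - 2 * b < \<alpha>" by blast
  \<comment> \<open>The inserted \<open>0\<close> does not exceed \<open>1 - 2b\<close>.\<close>
  then have "\<alpha> \<in> X" using assms(2) by auto
  then obtain \<mu> where \<alpha>1: "\<alpha> \<le> 1" and \<mu>: "supports_prob_measure E \<mu>"
    and decay: "(\<lambda>u::int. (cmod (fourier_measure \<mu> u))\<^sup>2)
          \<in> o[filtercomap (\<lambda>u. \<bar>u\<bar>) at_top](\<lambda>u. \<bar>real_of_int u\<bar> powr (- \<alpha>))"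
    by (auto simp: X_def)
  have prob: "prob_space \<mu>" and "sets \<mu> = sets torus_borel" and in_E: "AE t in \<mu>. t \<in> E"
    using \<mu> by (auto simp: supports_prob_measure_def)
  then have char: "torus_char n \<in> borel_measurable \<mu>" for n
    by (intro torus_char_measurable)
  \<comment> \<open>The midpoint of \<open>1 - \<alpha>\<close> and \<open>2b\<close>; it is positive because \<open>\<alpha> \<le> 1\<close>.\<close>
  define \<gamma> where "\<gamma> = (1 - \<alpha> + 2 * b) / 2"
  have \<gamma>: "0 < \<gamma>" "\<gamma> < 2 * b" "1 < \<alpha> + \<gamma>"
    using \<alpha> \<alpha>1 by (auto simp: \<gamma>_def field_simps)
  have "AE t in \<mu>. convergent (\<lambda>N. fourier_partial_sum f N t)"
    unfolding fourier_partial_sum_def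
    using summable_energy_of_smallo[OF decay, of \<gamma>] \<gamma>
    by (intro AE_convergent_of_energy[OF prob char \<gamma>(1,2) _ sum_freq_block_le[OF assms(1,4)]]) auto
  with in_E have "AE t in \<mu>. t \<in> E \<and> convergent (\<lambda>N. fourier_partial_sum f N t)"
    by eventually_elim simp
  then show ?thesis
    using eventually_happens'[OF prob_space.ae_filter_bot[OF prob]] by blast
qed

end
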